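(* Let $a\in\{0,1\}$ and $\ell\ge 2$. The word $a^\ell$ satisfies Property P if and only if $\ell$ is a power of $2$.
   Context: For $n\ge 0$ and a word $w$ over $\{0,1\}$, $s_w(n)$ is the number of occurrences of $w$ as a scattered subsequence (not necessarily contiguous) of the binary expansion of $n$ without leading zeros (the binary expansion of $0$ is the word $0$). $a^\ell$ denotes the word consisting of $\ell$ copies of the letter $a$. A word $w$ satisfies Property P if there exists $\epsilon>0$ such that $\left|\sum_{n=0}^N(-1)^{s_w(n)}\right|=O(N^{1-\epsilon})$ as $N\to\infty$. *)

theory Defs
  imports Complex_Main "HOL-Library.Landau_Symbols"
begin

text \<open>Words over \<open>{0,1}\<close> are lists of natural numbers, with the most significant digit first.\<close>

fun bin_expansion :: "nat \<Rightarrow> nat list" where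
  "bin_expansion n = (if n < 2 then [n] else bin_expansion (n div 2) @ [n mod 2])"

declare bin_expansion.simps [simp del]

text \<open>An occurrence is identified with its set of positions, so different position sets that
  spell the same word are counted separately.\<close>

definition scattered_occurrences :: "'a list \<Rightarrow> 'a list \<Rightarrow> nat" where
  "scattered_occurrences w xs = card {I. I \<subseteq> {..<length xs} \<and> nths xs I = w}"

definition subseq_count :: "nat list \<Rightarrow> nat \<Rightarrow> nat" where
  "subseq_count w n = scattered_occurrences w (bin_expansion n)"

definition property_P :: "nat list \<Rightarrow> bool" where
  "property_P w \<longleftrightarrow>
     (\<exists>\<epsilon>::real. \<epsilon> > 0 \<and>
       (\<lambda>N::nat. \<bar>\<Sum>n=0..N. (-1::real) ^ subseq_count w n\<bar>) \<in> O(\<lambda>N. real N powr (1 - \<epsilon>)))"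

end

theory Submission
  imports Defs
begin

text \<open>If \<open>n\<close> has \<open>m\<close> digits equal to \<open>a\<close>, then \<open>a\<^sup>l\<close> occurs \<open>m choose l\<close> times, so the sign
  is \<open>F m\<close> with \<open>F m = (-1) ^ (m choose l)\<close>. The sum of the signs over all \<open>n\<close> that extend a fixed prefix by
  \<open>L\<close> free digits obeys \<open>T (L + 1) s = T L s + T L (s + 1)\<close>, where \<open>s\<close> counts the \<open>a\<close>'s of the prefix.

  If \<open>l = q\<close> is a power of two, then \<open>F (m + q) = - F m\<close>, so the two extreme terms of the binomial
  expansion of \<open>T (L + q) s\<close> cancel and \<open>T\<close> grows at most like \<open>(2 ^ q - 2) powr (L / q)\<close>; a dyadic
  decomposition of \<open>{0..N}\<close> gives the power saving. If \<open>2 ^ k < l < 2 ^ (k + 1)\<close>, then \<open>F\<close> is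
  periodic modulo \<open>p = 2 ^ (k + 1)\<close>, and the sum of \<open>T L s\<close> over the residues \<open>s\<close> modulo \<open>p\<close> is
  \<open>2 ^ L\<close> times the sum of \<open>F\<close> over a period. The latter is positive because \<open>F m = 1\<close> for all
  \<open>m < l\<close>, which is more than half of the period, so some prefix class has sums of order \<open>2 ^ L\<close>.\<close>

section \<open>Parity of binomial coefficients\<close>

text \<open>Absorption gives \<open>2 ^ k dvd i * (2 ^ k choose i)\<close>; an odd binomial would
  force \<open>2 ^ k dvd i\<close>.\<close>

lemma even_choose_two_power:
  assumes "0 < i" "i < 2 ^ k"
  shows "even (2 ^ k choose i)"
proof (rule ccontr)
  assume "odd (2 ^ k choose i)"
  then have cop: "coprime (2 ^ k) (2 ^ k choose i)" by simp
  have "i * (2 ^ k choose i) = 2 ^ k * ((2 ^ k - 1) choose (i - 1))"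
    using assms by (simp add: times_binomial_minus1_eq)
  then have "2 ^ k dvd i * (2 ^ k choose i)" by simp
  then have "2 ^ k dvd i" using cop by (simp add: coprime_dvd_mult_left_iff)
  then show False using assms by (auto dest: dvd_imp_le)
qed

text \<open>In the Vandermonde expansion only the terms \<open>i = 0\<close> and
  \<open>i = l\<close> can be odd, and the latter only for \<open>l = 2 ^ k\<close>. This yields
  antiperiodic signs for \<open>l = 2 ^ k\<close> and periodic ones for smaller
  \<open>l\<close>.\<close>

lemma even_choose_add_two_power:
  assumes "l \<le> 2 ^ k" "0 < l"
  shows "even ((m + 2 ^ k) choose l) \<longleftrightarrow> even ((m choose l) + (if l = 2 ^ k then 1 else 0))"
proof -
  define f where "f i = (2 ^ k choose i) * (m choose (l - i))" for i
  have "(m + 2 ^ k) choose l = (\<Sum>i\<le>l. f i)"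
    using vandermonde[of "2 ^ k" m l] by (simp add: f_def add.commute)
  also have "{..l} = insert 0 (insert l {0<..<l})" using assms by auto
  also have "(\<Sum>i\<in>insert 0 (insert l {0<..<l}). f i) = f 0 + f l + (\<Sum>i\<in>{0<..<l}. f i)"
    using assms by simp
  finally have eq: "(m + 2 ^ k) choose l = f 0 + f l + (\<Sum>i\<in>{0<..<l}. f i)" .
  have "even (\<Sum>i\<in>{0<..<l}. f i)"
    using assms by (intro dvd_sum) (auto simp: f_def intro!: even_choose_two_power)
  moreover have "even (f l) \<longleftrightarrow> l \<noteq> 2 ^ k"
    using assms even_choose_two_power[of l k] by (auto simp: f_def)
  ultimately show ?thesis by (simp add: eq f_def)
qed

section \<open>Occurrences of constant words\<close>

lemma nths_eq_replicate_iff: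
  assumes "I \<subseteq> {..<length xs}"
  shows "nths xs I = replicate l a \<longleftrightarrow> I \<subseteq> {i. i < length xs \<and> xs ! i = a} \<and> card I = l"
proof -
  have "{i. i < length xs \<and> i \<in> I} = I" using assms by auto
  then have "length (nths xs I) = card I" by (simp add: length_nths)
  moreover have "set (nths xs I) = {xs ! i |i. i \<in> I}" using assms by (auto simp: set_nths)
  ultimately show ?thesis using assms by (auto intro!: replicate_eqI)
qed

lemma scattered_occurrences_replicate:
  "scattered_occurrences (replicate l a) xs = count_list xs a choose l"
proof -
  let ?A = "{i. i < length xs \<and> xs ! i = a}"
  have "{I. I \<subseteq> {..<length xs} \<and> nths xs I = replicate l a} = {I. I \<subseteq> ?A \<and> card I = l}"
    using nths_eq_replicate_iff[of _ xs l a] by blast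
  moreover have "count_list xs a = card ?A"
    by (simp add: count_list_eq_length_filter length_filter_conv_card eq_commute)
  ultimately show ?thesis
    by (simp add: scattered_occurrences_def n_subsets)
qed

definition digit_count :: "nat \<Rightarrow> nat \<Rightarrow> nat" where
  "digit_count a n = count_list (bin_expansion n) a"

text \<open>Zero is excluded because its expansion is the word 0, which is not a prefix of the
  expansion of 1.\<close>

lemma digit_count_append:
  assumes "n \<ge> 1" "b < 2"
  shows "digit_count a (2 * n + b) = digit_count a n + (if b = a then 1 else 0)"
  using assms by (subst digit_count_def, subst bin_expansion.simps) (auto simp: digit_count_def)

lemma ex_digit_count:
  assumes "a < 2" "s \<ge> 1"
  shows "\<exists>n\<ge>1. digit_count a n = s"
  using assms(2)
proof (induction s rule: dec_induct)
  case base
  show ?case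
  proof (cases "a = 1")
    case True
    then show ?thesis by (intro exI[of _ 1]) (simp add: digit_count_def bin_expansion.simps)
  next
    case False
    then show ?thesis using assms(1)
      by (intro exI[of _ 2]) (simp add: digit_count_def bin_expansion.simps)
  qed
next
  case (step s)
  then obtain n where "n \<ge> 1" "digit_count a n = s" by auto
  then show ?case using assms(1) digit_count_append[of n a a] by (intro exI[of _ "2 * n + a"]) auto
qed

section \<open>Sums over a dyadic block\<close>

text \<open>In closed form, the sum of \<open>(L choose j) * F (s + j)\<close> over
  \<open>j \<le> L\<close>.\<close>

fun block_sum :: "(nat \<Rightarrow> real) \<Rightarrow> nat \<Rightarrow> nat \<Rightarrow> real" where
  "block_sum F 0 s = F s"
| "block_sum F (Suc L) s = block_sum F L s + block_sum F L (Suc s)"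

lemma sum_dyadic_block:
  assumes "a < 2" "P \<ge> 1"
  shows "(\<Sum>n\<in>{P * 2 ^ L..<(P + 1) * 2 ^ L}. F (digit_count a n)) = block_sum F L (digit_count a P)"
  using assms(2)
proof (induction L arbitrary: P)
  case 0
  then show ?case by simp
next
  case (Suc L)
  have "(\<Sum>n\<in>{P * 2 ^ Suc L..<(P + 1) * 2 ^ Suc L}. F (digit_count a n)) =
      (\<Sum>n\<in>{(2 * P + 0) * 2 ^ L..<(2 * P + 0 + 1) * 2 ^ L}. F (digit_count a n)) +
      (\<Sum>n\<in>{(2 * P + 1) * 2 ^ L..<(2 * P + 1 + 1) * 2 ^ L}. F (digit_count a n))"
    using sum.atLeastLessThan_concat[of "(2 * P) * 2 ^ L" "(2 * P + 1) * 2 ^ L" "(2 * P + 2) * 2 ^ L"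
        "\<lambda>n. F (digit_count a n)"]
    by (simp add: algebra_simps)
  also have "\<dots> = block_sum F L (digit_count a (2 * P + 0)) + block_sum F L (digit_count a (2 * P + 1))"
    using Suc by (intro arg_cong2[where f = "(+)"] Suc.IH) auto
  \<comment> \<open>Exactly one of the two appended digits equals \<open>a\<close>, so the two
    halves give the two terms of the recursion, in either order.\<close>
  also have "\<dots> = block_sum F (Suc L) (digit_count a P)"
    using assms(1) Suc.prems by (subst (1 2) digit_count_append) (auto simp: less_2_cases_iff)
  finally show ?case .
qed

lemma block_sum_add: "block_sum F (L + q) s = block_sum (block_sum F L) q s"
  by (induction q arbitrary: s) auto

lemma block_sum_shift: "block_sum F L (s + q) = block_sum (\<lambda>m. F (m + q)) L s"
  by (induction L arbitrary: s) (auto simp flip: add_Suc)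

lemma block_sum_uminus: "block_sum (\<lambda>m. - F m) L s = - block_sum F L s"
  by (induction L arbitrary: s) auto

lemma abs_block_sum_le:
  assumes "\<And>m. \<bar>F m\<bar> \<le> M"
  shows "\<bar>block_sum F L s\<bar> \<le> 2 ^ L * M"
proof (induction L arbitrary: s)
  case 0
  then show ?case using assms by simp
next
  case (Suc L)
  have "\<bar>block_sum F (Suc L) s\<bar> \<le> 2 ^ L * M + 2 ^ L * M"
    using Suc.IH[of s] Suc.IH[of "Suc s"] unfolding block_sum.simps by linarith
  then show ?case by (simp add: mult_ac)
qed

text \<open>Of the \<open>2 ^ Suc L\<close> values of \<open>F\<close> being added, the two extreme
  arguments occur once each; \<open>2 ^ Suc L - 2\<close> values remain.\<close>

lemma abs_block_sum_interior_le:
  assumes "\<And>m. \<bar>F m\<bar> \<le> M"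
  shows "\<bar>block_sum F (Suc L) s - F s - F (s + Suc L)\<bar> \<le> (2 ^ Suc L - 2) * M"
proof (induction L arbitrary: s)
  case 0
  then show ?case by simp
next
  case (Suc L)
  let ?D = "\<lambda>s. block_sum F (Suc L) s - F s - F (s + Suc L)"
  have "block_sum F (Suc (Suc L)) s - F s - F (s + Suc (Suc L))
      = ?D s + ?D (Suc s) + (F (s + Suc L) + F (Suc s))"
    by simp
  also have "\<bar>\<dots>\<bar> \<le> (2 ^ Suc L - 2) * M + (2 ^ Suc L - 2) * M + (M + M)"
    using Suc.IH[of s] Suc.IH[of "Suc s"] assms[of "s + Suc L"] assms[of "Suc s"] by linarith
  finally show ?case by (simp add: algebra_simps)
qed

section \<open>Power saving for antiperiodic signs\<close>

text \<open>Every \<open>q\<close> further digits cost a factor \<open>\<rho> ^ q\<close> instead of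
  \<open>2 ^ q\<close>. The constant \<open>2 ^ q\<close> absorbs the trivial bound for
  \<open>L < q\<close>.\<close>

lemma abs_block_sum_antiperiodic_le:
  assumes bound: "\<And>m. \<bar>F m\<bar> \<le> 1" and anti: "\<And>m. F (m + q) = - F m"
    and q: "q \<ge> 1" and \<rho>: "\<rho> \<ge> 1" "\<rho> ^ q = 2 ^ q - 2"
  shows "\<bar>block_sum F L s\<bar> \<le> 2 ^ q * \<rho> ^ L"
proof (induction L arbitrary: s rule: less_induct)
  case (less L)
  show ?case
  proof (cases "L < q")
    case True
    have "\<bar>block_sum F L s\<bar> \<le> 2 ^ L * 1" by (intro abs_block_sum_le bound)
    also have "\<dots> \<le> 2 ^ q * \<rho> ^ L"
      using True \<rho> by (intro mult_mono power_increasing one_le_power) auto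
    finally show ?thesis .
  next
    case False
    define G where "G = block_sum F (L - q)"
    have G: "G (s + q) = - G s" unfolding G_def
      by (subst block_sum_shift) (simp add: anti block_sum_uminus)
    have "\<bar>G m\<bar> \<le> 2 ^ q * \<rho> ^ (L - q)" for m
      unfolding G_def using less.IH[of "L - q"] False q by simp
    from abs_block_sum_interior_le[of G, OF this, of "q - 1" s]
    have "\<bar>block_sum G q s\<bar> \<le> (2 ^ q - 2) * (2 ^ q * \<rho> ^ (L - q))"
      using G q by simp
    also have "\<dots> = 2 ^ q * (\<rho> ^ q * \<rho> ^ (L - q))" using \<rho> by simp
    also have "\<dots> = 2 ^ q * \<rho> ^ L" using False by (simp flip: power_add)
    also have "block_sum G q s = block_sum F L s"
      using False by (simp add: G_def flip: block_sum_add)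
    finally show ?thesis .
  qed
qed

text \<open>Halving repeatedly, a partial block splits into at most one full block per level; the
  constant bounds the resulting geometric sum.\<close>

lemma abs_sum_partial_block_le:
  fixes f :: "nat \<Rightarrow> real"
  assumes block: "\<And>P L. P \<ge> 1 \<Longrightarrow> \<bar>\<Sum>n\<in>{P * 2 ^ L..<(P + 1) * 2 ^ L}. f n\<bar> \<le> C * \<rho> ^ L"
    and \<rho>: "\<rho> > 1" and P: "P \<ge> 1" and m: "m \<le> 2 ^ L"
  shows "\<bar>\<Sum>n\<in>{P * 2 ^ L..<P * 2 ^ L + m}. f n\<bar> \<le> C * \<rho> / (\<rho> - 1) * \<rho> ^ L"
  using P m
proof (induction L arbitrary: P m)
  case 0
  have C: "\<bar>f P\<bar> \<le> C" using block[of P 0] 0 by simp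
  then have "C * 1 \<le> C * (\<rho> / (\<rho> - 1))" using \<rho> by (intro mult_left_mono) auto
  moreover have "m = 0 \<or> m = 1" using 0 by auto
  ultimately show ?case using C by auto
next
  case (Suc L)
  define D where "D = C * \<rho> / (\<rho> - 1)"
  note IH = Suc.IH[folded D_def]
  have "0 \<le> C" using block[of 1 0] by simp
  then have D: "0 \<le> D" "D * (\<rho> - 1) = C * \<rho>" using \<rho> by (auto simp: D_def)
  have step: "C * \<rho> ^ L + D * \<rho> ^ L \<le> D * \<rho> ^ Suc L"
  proof -
    have "C * \<rho> ^ L \<le> C * \<rho> * \<rho> ^ L" using \<rho> \<open>0 \<le> C\<close>
      by (intro mult_right_mono) (auto simp: mult_le_cancel_left1)
    also have "\<dots> = D * (\<rho> - 1) * \<rho> ^ L" using D by simp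
    finally show ?thesis by (simp add: algebra_simps)
  qed
  have C\<rho>: "0 \<le> C * \<rho> ^ L" using \<open>0 \<le> C\<close> \<rho> by simp
  show ?case
  proof (cases "m \<le> 2 ^ L")
    case True
    then have "\<bar>\<Sum>n\<in>{(2 * P) * 2 ^ L..<(2 * P) * 2 ^ L + m}. f n\<bar> \<le> D * \<rho> ^ L"
      using Suc.prems by (intro IH) auto
    then show ?thesis unfolding D_def[symmetric] using step C\<rho> by (simp add: mult_ac)
  next
    case False
    have "\<bar>\<Sum>n\<in>{(2 * P) * 2 ^ L..<(2 * P + 1) * 2 ^ L}. f n\<bar> \<le> C * \<rho> ^ L"
      using Suc.prems by (intro block) auto
    moreover have "\<bar>\<Sum>n\<in>{(2 * P + 1) * 2 ^ L..<(2 * P + 1) * 2 ^ L + (m - 2 ^ L)}. f n\<bar> \<le> D * \<rho> ^ L"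
      using Suc.prems False by (intro IH) auto
    moreover have "(\<Sum>n\<in>{P * 2 ^ Suc L..<P * 2 ^ Suc L + m}. f n) =
        (\<Sum>n\<in>{(2 * P) * 2 ^ L..<(2 * P + 1) * 2 ^ L}. f n) +
        (\<Sum>n\<in>{(2 * P + 1) * 2 ^ L..<(2 * P + 1) * 2 ^ L + (m - 2 ^ L)}. f n)"
      using False by (subst sum.atLeastLessThan_concat) (auto simp: algebra_simps)
    ultimately show ?thesis unfolding D_def[symmetric] using step by linarith
  qed
qed

text \<open>Cutting at powers of two leaves full blocks with \<open>P = 1\<close> and one partial
  block. Summing the partial-block bound over the levels is a second geometric sum, hence the
  square.\<close>

lemma abs_sum_initial_le:
  fixes f :: "nat \<Rightarrow> real"
  assumes block: "\<And>P L. P \<ge> 1 \<Longrightarrow> \<bar>\<Sum>n\<in>{P * 2 ^ L..<(P + 1) * 2 ^ L}. f n\<bar> \<le> C * \<rho> ^ L"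
    and \<rho>: "\<rho> > 1" and M: "1 \<le> M" "M \<le> 2 ^ L"
  shows "\<bar>\<Sum>n\<in>{1..<M}. f n\<bar> \<le> C * \<rho> / (\<rho> - 1)\<^sup>2 * \<rho> ^ L"
  using M
proof (induction L arbitrary: M)
  case 0
  have "0 \<le> C" using block[of 1 0] by simp
  then show ?case using 0 \<rho> by simp
next
  case (Suc L)
  define D E where "D = C * \<rho> / (\<rho> - 1)" and "E = C * \<rho> / (\<rho> - 1)\<^sup>2"
  note IH = Suc.IH[folded E_def]
  have "0 \<le> C" using block[of 1 0] by simp
  then have D: "0 \<le> D * \<rho> ^ L" using \<rho> by (auto simp: D_def)
  have "E * (\<rho> - 1) = D" using \<rho> by (simp add: D_def E_def power2_eq_square)
  then have "D * \<rho> ^ L = E * (\<rho> - 1) * \<rho> ^ L" by simp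
  then have step: "E * \<rho> ^ L + D * \<rho> ^ L = E * \<rho> ^ Suc L" by (simp add: algebra_simps)
  show ?case
  proof (cases "M \<le> 2 ^ L")
    case True
    then show ?thesis unfolding E_def[symmetric] using IH[of M] Suc.prems step D by linarith
  next
    case False
    have "\<bar>\<Sum>n\<in>{1..<2 ^ L}. f n\<bar> \<le> E * \<rho> ^ L" by (intro IH) auto
    moreover have "\<bar>\<Sum>n\<in>{1 * 2 ^ L..<1 * 2 ^ L + (M - 2 ^ L)}. f n\<bar> \<le> D * \<rho> ^ L"
      unfolding D_def using False Suc.prems by (intro abs_sum_partial_block_le block \<rho>) auto
    moreover have "(\<Sum>n\<in>{1..<M}. f n) =
        (\<Sum>n\<in>{1..<2 ^ L}. f n) + (\<Sum>n\<in>{1 * 2 ^ L..<1 * 2 ^ L + (M - 2 ^ L)}. f n)"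
      using False sum.atLeastLessThan_concat[of 1 "2 ^ L" M f] by simp
    ultimately show ?thesis unfolding E_def[symmetric] using step by linarith
  qed
qed

text \<open>For \<open>2 ^ L \<le> N\<close>, \<open>\<rho> ^ L = (2 ^ L) powr log 2 \<rho>\<close>
  is at most \<open>N powr log 2 \<rho>\<close>. The term \<open>f 0\<close> lies outside the blocks
  and goes into the constant.\<close>

lemma sum_bigo_of_block_bound:
  fixes f :: "nat \<Rightarrow> real"
  assumes block: "\<And>P L. P \<ge> 1 \<Longrightarrow> \<bar>\<Sum>n\<in>{P * 2 ^ L..<(P + 1) * 2 ^ L}. f n\<bar> \<le> C * \<rho> ^ L"
    and \<rho>: "\<rho> > 1"
  shows "(\<lambda>N. \<bar>\<Sum>n=0..N. f n\<bar>) \<in> O(\<lambda>N. real N powr log 2 \<rho>)"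
proof -
  define E where "E = C * \<rho> / (\<rho> - 1)\<^sup>2"
  have "0 \<le> C" using block[of 1 0] by simp
  then have E: "0 \<le> E" using \<rho> by (simp add: E_def)
  have "\<bar>\<Sum>n=0..N. f n\<bar> \<le> (\<bar>f 0\<bar> + E * \<rho>) * real N powr log 2 \<rho>" if N: "N \<ge> 1" for N
  proof -
    obtain L where L: "2 ^ L \<le> N" "N < 2 ^ (L + 1)"
      using ex_power_ivl1[of 2 N] N by auto
    have "(\<Sum>n=0..N. f n) = f 0 + (\<Sum>n\<in>{1..<Suc N}. f n)"
      by (simp add: sum.atLeast_Suc_atMost atLeastLessThanSuc_atLeastAtMost)
    moreover have "\<bar>\<Sum>n\<in>{1..<Suc N}. f n\<bar> \<le> E * \<rho> ^ (L + 1)"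
      unfolding E_def using L by (intro abs_sum_initial_le block \<rho>) auto
    ultimately have "\<bar>\<Sum>n=0..N. f n\<bar> \<le> \<bar>f 0\<bar> * 1 + E * \<rho> * \<rho> ^ L"
      by (simp add: mult_ac)
    also have "\<dots> \<le> (\<bar>f 0\<bar> + E * \<rho>) * \<rho> ^ L"
      using \<rho> mult_left_mono[OF one_le_power[of \<rho> L], of "\<bar>f 0\<bar>"] by (simp add: distrib_right)
    also have "\<rho> ^ L = (2 powr log 2 \<rho>) powr real L" using \<rho> by (simp add: powr_realpow)
    also have "\<dots> = (2 ^ L) powr log 2 \<rho>"
      by (simp add: powr_powr mult.commute flip: powr_realpow)
    also have "(\<bar>f 0\<bar> + E * \<rho>) * (2 ^ L) powr log 2 \<rho> \<le> (\<bar>f 0\<bar> + E * \<rho>) * real N powr log 2 \<rho>"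
      using L \<rho> E by (intro mult_left_mono powr_mono2) (auto simp: zero_le_log_cancel_iff)
    finally show ?thesis .
  qed
  then show ?thesis
    by (intro bigoI[of _ "\<bar>f 0\<bar> + E * \<rho>"] eventually_mono[OF eventually_ge_at_top[of 1]]) auto
qed

section \<open>Periodic signs with nonzero mean\<close>

text \<open>A shift permutes the residues, so both terms of the recursion have the same sum over a
  period.\<close>

lemma sum_block_sum_period:
  assumes per: "\<And>m. F (m + p) = F m"
  shows "(\<Sum>s<p. block_sum F L s) = 2 ^ L * (\<Sum>s<p. F s)"
proof (induction L)
  case 0
  then show ?case by simp
next
  case (Suc L)
  have "block_sum F L (0 + p) = block_sum F L 0"
    by (subst block_sum_shift) (simp add: per)
  then have "(\<Sum>s<p. block_sum F L (Suc s)) = (\<Sum>s<p. block_sum F L s)"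
    using sum.lessThan_Suc_shift[of "block_sum F L" p] sum.lessThan_Suc[of "block_sum F L" p] by simp
  then show ?case using Suc.IH by (simp add: sum.distrib)
qed

text \<open>A block is the difference of two initial segments whose lengths are fixed multiples of
  \<open>2 ^ L\<close>.\<close>

lemma block_average_tendsto_0:
  fixes f :: "nat \<Rightarrow> real"
  assumes lim: "(\<lambda>N. (\<Sum>n<N. f n) / real N) \<longlonglongrightarrow> 0" and P: "P \<ge> 1"
  shows "(\<lambda>L. (\<Sum>n\<in>{P * 2 ^ L..<(P + 1) * 2 ^ L}. f n) / 2 ^ L) \<longlonglongrightarrow> 0"
proof -
  have *: "(\<lambda>L. (\<Sum>n<Q * 2 ^ L. f n) / 2 ^ L) \<longlonglongrightarrow> 0" if Q: "Q \<ge> 1" for Q :: nat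
  proof -
    have "L \<le> Q * 2 ^ L" for L
      using Q less_exp[of L] by (metis less_imp_le mult_le_mono mult_1 order_trans)
    then have "filterlim (\<lambda>L. Q * 2 ^ L) at_top at_top"
      by (intro filterlim_at_top_mono[OF filterlim_ident] always_eventually) auto
    from filterlim_compose[OF lim this]
    have "(\<lambda>L. real Q * ((\<Sum>n<Q * 2 ^ L. f n) / real (Q * 2 ^ L))) \<longlonglongrightarrow> real Q * 0"
      by (intro tendsto_mult_left)
    then show ?thesis using Q by simp
  qed
  have "(\<Sum>n\<in>{P * 2 ^ L..<(P + 1) * 2 ^ L}. f n)
      = (\<Sum>n<(P + 1) * 2 ^ L. f n) - (\<Sum>n<P * 2 ^ L. f n)" for L
    using sum_diff_nat_ivl[of 0 "P * 2 ^ L" "(P + 1) * 2 ^ L" f]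
    by (simp add: lessThan_atLeast0)
  then show ?thesis
    using tendsto_diff[OF *[of "P + 1"] *[OF P]] by (simp add: diff_divide_distrib)
qed

lemma sum_period_eq_0:
  assumes a: "a < 2" and p: "p \<ge> 1" and per: "\<And>m. F (m + p) = F m"
    and lim: "(\<lambda>N. (\<Sum>n<N. F (digit_count a n)) / real N) \<longlonglongrightarrow> 0"
  shows "(\<Sum>s<p. F s) = 0"
proof -
  have "(\<lambda>L. block_sum F L s / 2 ^ L) \<longlonglongrightarrow> 0" for s
  proof -
    \<comment> \<open>Taking \<open>s + p\<close> instead of \<open>s\<close> keeps the count
      positive, so that a prefix exists even for \<open>s = 0\<close>.\<close>
    obtain P where P: "P \<ge> 1" "digit_count a P = s + p"
      using ex_digit_count[OF a, of "s + p"] p by auto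
    have "block_sum F L (s + p) = block_sum F L s" for L
      by (subst block_sum_shift) (simp add: per)
    then show ?thesis
      using block_average_tendsto_0[OF lim P(1)] P by (simp only: sum_dyadic_block[OF a P(1)])
  qed
  then have "(\<lambda>L. \<Sum>s<p. block_sum F L s / 2 ^ L) \<longlonglongrightarrow> (\<Sum>s<p. 0)"
    by (intro tendsto_sum)
  then have "(\<lambda>L::nat. \<Sum>s<p. F s) \<longlonglongrightarrow> 0"
    by (simp add: sum_block_sum_period per flip: sum_divide_distrib)
  then show ?thesis by (simp add: LIMSEQ_const_iff)
qed

lemma average_tendsto_0_of_bigo:
  fixes f :: "nat \<Rightarrow> real"
  assumes "\<epsilon> > 0" and "(\<lambda>N. \<bar>\<Sum>n=0..N. f n\<bar>) \<in> O(\<lambda>N. real N powr (1 - \<epsilon>))"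
  shows "(\<lambda>N. (\<Sum>n<N. f n) / real N) \<longlonglongrightarrow> 0"
proof -
  have "(\<lambda>N. real N powr (1 - \<epsilon>)) \<in> o(\<lambda>N. real N powr 1)"
    using assms(1) by (subst powr_smallo_iff) (auto simp: filterlim_real_sequentially)
  \<comment> \<open>\<open>Suc N\<close> is the number of terms in \<open>{0..N}\<close>; the index
    is shifted back at the end.\<close>
  moreover have "(\<lambda>N. real N powr 1) \<in> O(\<lambda>N. real (Suc N))"
    by (intro bigoI[of _ 1]) simp
  ultimately have "(\<lambda>N. real N powr (1 - \<epsilon>)) \<in> o(\<lambda>N. real (Suc N))"
    by (rule landau_o.small_big_trans)
  with assms(2) have "(\<lambda>N. \<bar>\<Sum>n=0..N. f n\<bar>) \<in> o(\<lambda>N. real (Suc N))"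
    by (rule landau_o.big_small_trans)
  then have "(\<lambda>N. (\<Sum>n=0..N. f n)) \<in> o(\<lambda>N. real (Suc N))"
    by (simp add: landau_o.small.abs_in_iff)
  then have "(\<lambda>N. (\<Sum>n=0..N. f n) / real (Suc N)) \<longlonglongrightarrow> 0"
    by (rule smalloD_tendsto)
  then have "(\<lambda>N. (\<Sum>n<Suc N. f n) / real (Suc N)) \<longlonglongrightarrow> 0"
    by (simp only: atLeast0AtMost lessThan_Suc_atMost)
  then show ?thesis by (rule LIMSEQ_imp_Suc)
qed

section \<open>Constant words\<close>

lemma property_P_replicate_two_power:
  assumes a: "a < 2" and k: "k \<ge> 1"
  shows "property_P (replicate (2 ^ k) a)"
proof -
  define q :: nat where "q = 2 ^ k"
  define F :: "nat \<Rightarrow> real" where "F m = (-1) ^ (m choose q)" for m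
  define \<rho> where "\<rho> = root q (2 ^ q - 2)"
  \<comment> \<open>\<open>q \<ge> 2\<close> makes \<open>2 ^ q - 2\<close> exceed 1, hence
    \<open>\<rho> > 1\<close> as the geometric sums require; \<open>\<rho> < 2\<close> gives the
    saving.\<close>
  have "(2::nat) ^ 1 \<le> q" unfolding q_def using k by (intro power_increasing) auto
  then have q: "q \<ge> 2" by simp
  then have "(2::real) ^ 2 \<le> 2 ^ q" by (intro power_increasing) auto
  then have "(1::real) < 2 ^ q - 2" by simp
  then have \<rho>: "\<rho> > 1" "\<rho> ^ q = 2 ^ q - 2" using q by (auto simp: \<rho>_def)
  have "\<rho> ^ q < 2 ^ q" using \<rho> by simp
  then have \<rho>2: "\<rho> < 2" by (rule power_less_imp_less_base) simp
  have anti: "F (m + q) = - F m" for m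
    using even_choose_add_two_power[of q k m] q
    by (cases "even (m choose q)") (auto simp: F_def q_def)
  have bound: "\<bar>F m\<bar> \<le> 1" for m by (simp add: F_def power_abs)
  have "\<bar>\<Sum>n\<in>{P * 2 ^ L..<(P + 1) * 2 ^ L}. F (digit_count a n)\<bar> \<le> 2 ^ q * \<rho> ^ L"
    if "P \<ge> 1" for P L
    unfolding sum_dyadic_block[OF a that]
    using \<rho> q by (intro abs_block_sum_antiperiodic_le bound anti) auto
  from sum_bigo_of_block_bound[OF this \<rho>(1)]
  have "(\<lambda>N. \<bar>\<Sum>n=0..N. F (digit_count a n)\<bar>) \<in> O(\<lambda>N. real N powr log 2 \<rho>)" .
  moreover have "log 2 \<rho> < 1" using \<rho>(1) \<rho>2 by simp
  ultimately show ?thesis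
    unfolding property_P_def subseq_count_def scattered_occurrences_replicate
    by (intro exI[of _ "1 - log 2 \<rho>"]) (simp add: F_def digit_count_def q_def)
qed

lemma not_property_P_replicate:
  assumes a: "a < 2" and l: "2 ^ k < l" "l < 2 ^ Suc k"
  shows "\<not> property_P (replicate l a)"
proof
  assume "property_P (replicate l a)"
  define F :: "nat \<Rightarrow> real" where "F m = (-1) ^ (m choose l)" for m
  define p :: nat where "p = 2 ^ Suc k"
  obtain \<epsilon> where "\<epsilon> > 0"
    and "(\<lambda>N. \<bar>\<Sum>n=0..N. F (digit_count a n)\<bar>) \<in> O(\<lambda>N. real N powr (1 - \<epsilon>))"
    using \<open>property_P _\<close>
    unfolding property_P_def subseq_count_def scattered_occurrences_replicate F_def digit_count_def
    by blast
  then have "(\<lambda>N. (\<Sum>n<N. F (digit_count a n)) / real N) \<longlonglongrightarrow> 0"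
    by (rule average_tendsto_0_of_bigo)
  moreover have "F (m + p) = F m" for m
    using even_choose_add_two_power[of l "Suc k" m] l
    by (cases "even (m choose l)") (auto simp: F_def p_def)
  ultimately have "(\<Sum>s<p. F s) = 0"
    using a by (intro sum_period_eq_0[of a]) (auto simp: p_def)
  moreover have "(\<Sum>s<p. F s) > 0"
  proof -
    \<comment> \<open>The first \<open>l\<close> signs are 1 and the other \<open>p - l\<close> are
      at least -1, so the sum is at least \<open>2 * l - p\<close>.\<close>
    have lp: "l \<le> p" "p < 2 * l" using l by (auto simp: p_def)
    have "(\<Sum>s\<in>{0..<l}. F s) = (\<Sum>s\<in>{0..<l}. 1)"
      by (intro sum.cong) (auto simp: F_def binomial_eq_0)
    moreover have "(\<Sum>s\<in>{l..<p}. F s) \<ge> (\<Sum>s\<in>{l..<p}. - 1)"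
      by (intro sum_mono) (auto simp: F_def minus_one_power_iff)
    moreover have "(\<Sum>s<p. F s) = (\<Sum>s\<in>{0..<l}. F s) + (\<Sum>s\<in>{l..<p}. F s)"
      using lp by (subst sum.atLeastLessThan_concat) (auto simp: lessThan_atLeast0)
    ultimately show ?thesis using lp by (simp add: of_nat_diff)
  qed
  ultimately show False by simp
qed

theorem theorem7p2:
  fixes a l :: nat
  assumes "a \<in> {0, 1}" and "l \<ge> 2"
  shows "property_P (replicate l a) \<longleftrightarrow> (\<exists>k::nat. l = 2 ^ k)"
proof
  have a: "a < 2" using assms(1) by auto
  show "\<exists>k. l = 2 ^ k" if "property_P (replicate l a)"
  proof -
    obtain k where "2 ^ k \<le> l" "l < 2 ^ (k + 1)"
      using ex_power_ivl1[of 2 l] assms(2) by auto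
    then show ?thesis
      using not_property_P_replicate[OF a, of k l] that by (cases "l = 2 ^ k") auto
  qed
  show "property_P (replicate l a)" if "\<exists>k. l = 2 ^ k"
  proof -
    from that obtain k where k: "l = 2 ^ k" by blast
    then have "k \<ge> 1" using assms(2) by (cases k) auto
    then show ?thesis using property_P_replicate_two_power[OF a] k by simp
  qed
qed

end
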